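(* Let $(\Omega,\mathcal{B},\mu)$ be a $\sigma$-finite measure space with $\mu(\Omega)=\infty$, let $T:\Omega\to\Omega$ be a non-singular, invertible, ergodic, conservative transformation, and let $f:\Omega\to\mathbb{R}$ be bounded and measurable. For $E\in\mathbb{C}$, $\omega\in\Omega$, $n\in\mathbb{Z}$ let $A(E,n,\omega)$ be the $n$-step transfer matrix. Then for any $E\in\mathbb{C}$ there exist finite numbers $\overline{L}^{\pm}(E)$, $\underline{L}^{\pm}(E)$ such that for $\mu$-a.e. $\omega\in\Omega$, for each choice of sign, $$\limsup_{n\to\pm\infty}\frac1{|n|}\log\|A(E,n,\omega)\|=\overline{L}^\pm(E),\qquad \liminf_{n\to\pm\infty}\frac1{|n|}\log\|A(E,n,\omega)\|=\underline{L}^\pm(E).$$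
   Context: A measurable transformation $T$ is: invertible if it is bijective and $T^{-1}$ is measurable; non-singular if, for $E\in\mathcal{B}$, $\mu(E)=0$ if and only if $\mu(T^{-1}E)=0$; ergodic if $T^{-1}E=E$ (with $E\in\mathcal{B}$) implies $\mu(E)=0$ or $\mu(\Omega\setminus E)=0$; conservative if there is no $W\in\mathcal{B}$ with $\mu(W)>0$ such that the sets $T^{-n}W$, $n\ge 0$, are pairwise disjoint. Transfer matrices: $A(E,\omega)=\begin{pmatrix}E-f(\omega)&-1\\1&0\end{pmatrix}$, and $A(E,n,\omega)=A(E,T^{n-1}\omega)\cdots A(E,\omega)$ for $n>0$, $A(E,0,\omega)=I$, $A(E,n,\omega)=A(E,T^{-|n|}\omega)^{-1}\cdots A(E,T^{-1}\omega)^{-1}$ for $n<0$. $\|\cdot\|$ is the operator norm on $2\times2$ matrices. *)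

theory Defs
  imports "HOL-Analysis.Analysis"
begin

section \<open>Transformations of a measure space\<close>

definition invertible_transformation :: "'a measure \<Rightarrow> ('a \<Rightarrow> 'a) \<Rightarrow> bool" where
  "invertible_transformation M T \<longleftrightarrow>
     bij_betw T (space M) (space M) \<and> inv_into (space M) T \<in> M \<rightarrow>\<^sub>M M"

definition nonsingular_transformation :: "'a measure \<Rightarrow> ('a \<Rightarrow> 'a) \<Rightarrow> bool" where
  "nonsingular_transformation M T \<longleftrightarrow>
     (\<forall>B\<in>sets M. emeasure M B = 0 \<longleftrightarrow> emeasure M (T -` B \<inter> space M) = 0)"

definition ergodic_transformation :: "'a measure \<Rightarrow> ('a \<Rightarrow> 'a) \<Rightarrow> bool" where
  "ergodic_transformation M T \<longleftrightarrow>
     (\<forall>B\<in>sets M. T -` B \<inter> space M = B \<longrightarrow>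
        emeasure M B = 0 \<or> emeasure M (space M - B) = 0)"

definition conservative_transformation :: "'a measure \<Rightarrow> ('a \<Rightarrow> 'a) \<Rightarrow> bool" where
  "conservative_transformation M T \<longleftrightarrow>
     \<not> (\<exists>W\<in>sets M. emeasure M W > 0 \<and>
          disjoint_family (\<lambda>n::nat. (T ^^ n) -` W \<inter> space M))"

section \<open>Transfer matrices\<close>

definition transfer_matrix :: "('a \<Rightarrow> real) \<Rightarrow> complex \<Rightarrow> 'a \<Rightarrow> complex^2^2" where
  "transfer_matrix f E \<omega> =
     vector [vector [E - complex_of_real (f \<omega>), -1],
             vector [1, 0]]"

primrec transfer_forward ::
    "('a \<Rightarrow> 'a) \<Rightarrow> ('a \<Rightarrow> real) \<Rightarrow> complex \<Rightarrow> nat \<Rightarrow> 'a \<Rightarrow> complex^2^2" where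
  "transfer_forward T f E 0 \<omega> = mat 1"
| "transfer_forward T f E (Suc n) \<omega> =
     transfer_matrix f E ((T ^^ n) \<omega>) ** transfer_forward T f E n \<omega>"

text \<open>The argument \<open>S\<close> is the inverse of the transformation: the \<open>n\<close>-th value is
  the product of the inverses of the matrices at \<open>S\<^sup>n \<omega>\<close>, \dots, \<open>S \<omega>\<close>, from left to right.\<close>

primrec transfer_backward ::
    "('a \<Rightarrow> 'a) \<Rightarrow> ('a \<Rightarrow> real) \<Rightarrow> complex \<Rightarrow> nat \<Rightarrow> 'a \<Rightarrow> complex^2^2" where
  "transfer_backward S f E 0 \<omega> = mat 1"
| "transfer_backward S f E (Suc n) \<omega> =
     matrix_inv (transfer_matrix f E ((S ^^ Suc n) \<omega>)) ** transfer_backward S f E n \<omega>"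

definition transfer_cocycle ::
    "'a measure \<Rightarrow> ('a \<Rightarrow> 'a) \<Rightarrow> ('a \<Rightarrow> real) \<Rightarrow> complex \<Rightarrow> int \<Rightarrow> 'a \<Rightarrow> complex^2^2" where
  "transfer_cocycle M T f E n \<omega> =
     (if n \<ge> 0 then transfer_forward T f E (nat n) \<omega>
      else transfer_backward (inv_into (space M) T) f E (nat \<bar>n\<bar>) \<omega>)"

text \<open>The operator norm is the one induced by the Euclidean norm on \<open>complex^2\<close>.\<close>

definition matrix_opnorm :: "complex^2^2 \<Rightarrow> real" where
  "matrix_opnorm A = onorm (\<lambda>v. A *v v)"

definition lyapunov_quotient ::
    "'a measure \<Rightarrow> ('a \<Rightarrow> 'a) \<Rightarrow> ('a \<Rightarrow> real) \<Rightarrow> complex \<Rightarrow> 'a \<Rightarrow> int \<Rightarrow> real" where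
  "lyapunov_quotient M T f E \<omega> n =
     1 / real_of_int \<bar>n\<bar> * ln (matrix_opnorm (transfer_cocycle M T f E n \<omega>))"

end

theory Submission
  imports Defs
begin

text \<open>
  Replacing \<open>\<omega>\<close> by \<open>T \<omega>\<close> removes one factor of the \<open>n\<close>-step transfer matrix and adds
  another one. Since \<open>f\<close> is bounded, the factors and their inverses have bounded norm, so this changes
  \<open>log \<parallel>A(E,n,\<omega>)\<parallel>\<close> by a bounded amount, which disappears after division by \<open>n\<close>. The upper
  and lower limits are therefore bounded \<open>T\<close>-invariant measurable functions, hence constant almost
  everywhere by ergodicity. Negative \<open>n\<close> are treated in the same way, with the inverse of \<open>T\<close>.
\<close>

section \<open>Invariant functions\<close>

text \<open>Every sublevel set of \<open>F\<close> at a rational height is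
  \<open>T\<close>-invariant, hence null or conull. Countably many such alternatives are settled
  simultaneously off one null set, and the rationals above a value determine it. The bound
  \<open>C\<close> makes the constant finite.\<close>

lemma ergodic_invariant_AE_const:
  fixes F :: "'a \<Rightarrow> ereal"
  assumes erg: "ergodic_transformation M T" and T: "T \<in> M \<rightarrow>\<^sub>M M"
    and [measurable]: "F \<in> borel_measurable M"
    and inv: "\<And>\<omega>. \<omega> \<in> space M \<Longrightarrow> F (T \<omega>) = F \<omega>"
    and bdd: "\<And>\<omega>. \<omega> \<in> space M \<Longrightarrow> \<bar>F \<omega>\<bar> \<le> ereal C"
  shows "\<exists>c::real. AE \<omega> in M. F \<omega> = ereal c"
proof (cases "emeasure M (space M) = 0")
  case True
  then have "AE \<omega> in M. F \<omega> = ereal 0"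
    by (intro AE_I[of _ _ "space M"]) auto
  then show ?thesis by blast
next
  case False
  \<comment> \<open>\<open>Q r\<close> records which alternative holds at height \<open>r\<close>:
    the sublevel set is not null, hence conull.\<close>
  define Q where "Q r \<longleftrightarrow> emeasure M {\<omega> \<in> space M. F \<omega> < ereal (real_of_rat r)} \<noteq> 0" for r
  have "AE \<omega> in M. F \<omega> < ereal (real_of_rat r) \<longleftrightarrow> Q r" for r
  proof -
    let ?B = "{\<omega> \<in> space M. F \<omega> < ereal (real_of_rat r)}"
    have B: "?B \<in> sets M" by measurable
    have "T -` ?B \<inter> space M = ?B"
      using inv measurable_space[OF T] by auto
    with erg B have "emeasure M ?B = 0 \<or> emeasure M (space M - ?B) = 0"
      unfolding ergodic_transformation_def by blast
    then show ?thesis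
    proof
      assume "emeasure M ?B = 0"
      then show ?thesis using B by (intro AE_I[of _ _ ?B]) (auto simp: Q_def)
    next
      assume 0: "emeasure M (space M - ?B) = 0"
      have "Q r"
      \<comment> \<open>Otherwise both the sublevel set and its complement would be null, and so
        would the whole space.\<close>
      proof (rule ccontr)
        assume "\<not> Q r"
        then have "emeasure M ?B + emeasure M (space M - ?B) = 0"
          using 0 by (simp add: Q_def)
        moreover have "emeasure M ?B + emeasure M (space M - ?B) = emeasure M (space M)"
          using B by (subst plus_emeasure) (auto intro: arg_cong[where f = "emeasure M"])
        ultimately show False using False by simp
      qed
      then show ?thesis using 0 B by (intro AE_I[of _ _ "space M - ?B"]) auto
    qed
  qed
  then have ae: "AE \<omega> in M. \<forall>r. F \<omega> < ereal (real_of_rat r) \<longleftrightarrow> Q r"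
    by (simp add: AE_all_countable)
  \<comment> \<open>A property that holds almost everywhere holds somewhere, because the space is
    not null. The value of \<open>F\<close> at such a point is the desired constant.\<close>
  have "\<exists>\<omega>0\<in>space M. \<forall>r. F \<omega>0 < ereal (real_of_rat r) \<longleftrightarrow> Q r"
  proof (rule ccontr)
    assume "\<not> ?thesis"
    with ae have "AE \<omega> in M. False" by (auto elim: eventually_mono)
    with False show False by (simp add: AE_iff_null null_sets_def)
  qed
  then obtain \<omega>0 where \<omega>0: "\<omega>0 \<in> space M" "\<And>r. F \<omega>0 < ereal (real_of_rat r) \<longleftrightarrow> Q r"
    by blast
  obtain c where c: "F \<omega>0 = ereal c"
    using bdd[OF \<omega>0(1)] by (cases "F \<omega>0") auto
  have "F \<omega> = F \<omega>0" if "\<forall>r. F \<omega> < ereal (real_of_rat r) \<longleftrightarrow> Q r" for \<omega>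
  proof (rule antisym; rule leI; rule notI)
    assume "F \<omega>0 < F \<omega>"
    then obtain r where "F \<omega>0 < ereal (real_of_rat r)" "ereal (real_of_rat r) < F \<omega>"
      using ereal_dense3 by blast
    then show False using that \<omega>0(2) by (auto dest: order.asym)
  next
    assume "F \<omega> < F \<omega>0"
    then obtain r where "F \<omega> < ereal (real_of_rat r)" "ereal (real_of_rat r) < F \<omega>0"
      using ereal_dense3 by blast
    then show False using that \<omega>0(2) by (auto dest: order.asym)
  qed
  with ae c have "AE \<omega> in M. F \<omega> = ereal c" by (auto elim: eventually_mono)
  then show ?thesis by blast
qed

text \<open>Adding a convergent sequence shifts both limits by its limit; here \<open>u\<close> is
  \<open>v\<close> plus a null sequence.\<close>

lemma Limsup_Liminf_eq_of_diff_tendsto_0: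
  fixes u v :: "nat \<Rightarrow> real"
  assumes "(\<lambda>n. u n - v n) \<longlonglongrightarrow> 0"
  shows "limsup (\<lambda>n. ereal (u n)) = limsup (\<lambda>n. ereal (v n))"
    and "liminf (\<lambda>n. ereal (u n)) = liminf (\<lambda>n. ereal (v n))"
proof -
  have lim: "(\<lambda>n. ereal (u n - v n)) \<longlonglongrightarrow> 0"
    using assms by (simp add: zero_ereal_def)
  have eq: "(\<lambda>n. ereal (u n)) = (\<lambda>n. ereal (u n - v n) + ereal (v n))" by simp
  show "limsup (\<lambda>n. ereal (u n)) = limsup (\<lambda>n. ereal (v n))"
    unfolding eq by (subst ereal_limsup_lim_add[OF lim]) auto
  show "liminf (\<lambda>n. ereal (u n)) = liminf (\<lambda>n. ereal (v n))"
    unfolding eq by (subst ereal_liminf_lim_add[OF lim]) auto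
qed

section \<open>The operator norm\<close>

lemma matrix_opnorm_mult_le: "matrix_opnorm (A ** B) \<le> matrix_opnorm A * matrix_opnorm B"
  using onorm_compose[OF matrix_vector_mul_bounded_linear[of A] matrix_vector_mul_bounded_linear[of B]]
  by (simp add: matrix_opnorm_def o_def matrix_vector_mul_assoc)

lemma matrix_opnorm_nonneg: "0 \<le> matrix_opnorm A"
  by (simp add: matrix_opnorm_def onorm_pos_le)

lemma matrix_opnorm_mat_1: "matrix_opnorm (mat 1) = 1"
  by (simp add: matrix_opnorm_def onorm_id)

text \<open>Sending a matrix to its operator is linear on a finite-dimensional space, hence
  continuous, and \<open>matrix_opnorm\<close> is this map followed by the norm of bounded
  operators. Both the measurability of the norms and their bounds on compact sets rest on
  this.\<close>

lemma continuous_on_matrix_opnorm: "continuous_on UNIV matrix_opnorm"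
proof -
  define L :: "complex^2^2 \<Rightarrow> (complex^2) \<Rightarrow>\<^sub>L (complex^2)" where "L A = Blinfun ((*v) A)" for A
  have L: "blinfun_apply (L A) = (*v) A" for A
    by (simp add: L_def bounded_linear_Blinfun_apply)
  have "linear L"
    by (intro linearI blinfun_eqI)
      (auto simp: L blinfun.add_left blinfun.scaleR_left
        matrix_vector_mult_def vec_eq_iff scaleR_sum_right sum.distrib algebra_simps)
  then have "bounded_linear L" by (simp add: linear_conv_bounded_linear)
  then have "continuous_on UNIV (\<lambda>A. norm (L A))"
    by (intro continuous_on_norm linear_continuous_on)
  moreover have "(\<lambda>A. norm (L A)) = matrix_opnorm"
    by (auto simp: norm_blinfun.rep_eq L matrix_opnorm_def)
  ultimately show ?thesis by argo
qed

section \<open>Bounded cocycles\<close>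

text \<open>A common form for both time directions: \<open>S\<close> is the transformation or its
  inverse, and \<open>g\<close> gives the matching factor.\<close>

primrec cocycle_product ::
    "('a \<Rightarrow> 'a) \<Rightarrow> ('a \<Rightarrow> complex^2^2) \<Rightarrow> nat \<Rightarrow> 'a \<Rightarrow> complex^2^2" where
  "cocycle_product S g 0 \<omega> = mat 1"
| "cocycle_product S g (Suc n) \<omega> = g ((S ^^ n) \<omega>) ** cocycle_product S g n \<omega>"

text \<open>The recursion splits off the leftmost factor. Splitting off the rightmost one instead
  relates the products at \<omega> and at \<open>S \<omega>\<close>.\<close>

lemma cocycle_product_Suc_right:
  "cocycle_product S g (Suc n) \<omega> = cocycle_product S g n (S \<omega>) ** g \<omega>"
proof (induction n)
  case (Suc n)
  have "cocycle_product S g (Suc (Suc n)) \<omega>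
      = g ((S ^^ Suc n) \<omega>) ** (cocycle_product S g n (S \<omega>) ** g \<omega>)"
    by (simp only: cocycle_product.simps(2)[of _ _ "Suc n"] Suc)
  then show ?case by (simp add: matrix_mul_assoc funpow_swap1)
qed simp

text \<open>\<open>h\<close> is the pointwise inverse of \<open>g\<close>. The common bound
  \<open>K\<close> lets one factor change a norm by at most \<open>K\<close>, up or down.\<close>

locale bounded_cocycle =
  fixes M :: "'a measure" and S :: "'a \<Rightarrow> 'a" and g h :: "'a \<Rightarrow> complex^2^2" and K :: real
  assumes S[measurable]: "S \<in> M \<rightarrow>\<^sub>M M"
    and g[measurable]: "g \<in> borel_measurable M"
    and gh: "\<And>\<omega>. \<omega> \<in> space M \<Longrightarrow> g \<omega> ** h \<omega> = mat 1"
    and hg: "\<And>\<omega>. \<omega> \<in> space M \<Longrightarrow> h \<omega> ** g \<omega> = mat 1"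
    and g_le: "\<And>\<omega>. \<omega> \<in> space M \<Longrightarrow> matrix_opnorm (g \<omega>) \<le> K"
    and h_le: "\<And>\<omega>. \<omega> \<in> space M \<Longrightarrow> matrix_opnorm (h \<omega>) \<le> K"
    and K: "1 \<le> K"
begin

abbreviation P :: "nat \<Rightarrow> 'a \<Rightarrow> complex^2^2" where "P \<equiv> cocycle_product S g"

definition logn :: "nat \<Rightarrow> 'a \<Rightarrow> real" where
  "logn n \<omega> = ln (matrix_opnorm (P n \<omega>))"

lemma funpow_in_space: "\<omega> \<in> space M \<Longrightarrow> (S ^^ n) \<omega> \<in> space M"
  by (induction n) (auto intro: measurable_space[OF S])

section \<open>Effect of a single factor on the norm\<close>

lemma opnorm_left:
  assumes "\<omega> \<in> space M"
  shows "matrix_opnorm (g \<omega> ** A) \<le> K * matrix_opnorm A"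
    and "matrix_opnorm A \<le> K * matrix_opnorm (g \<omega> ** A)"
proof -
  show "matrix_opnorm (g \<omega> ** A) \<le> K * matrix_opnorm A"
    using matrix_opnorm_mult_le[of "g \<omega>" A] mult_right_mono[OF g_le[OF assms] matrix_opnorm_nonneg[of A]]
    by linarith
  have "A = h \<omega> ** (g \<omega> ** A)" by (simp add: matrix_mul_assoc hg assms)
  then have "matrix_opnorm A \<le> matrix_opnorm (h \<omega>) * matrix_opnorm (g \<omega> ** A)"
    using matrix_opnorm_mult_le[of "h \<omega>" "g \<omega> ** A"] by simp
  also have "\<dots> \<le> K * matrix_opnorm (g \<omega> ** A)"
    by (intro mult_right_mono h_le assms matrix_opnorm_nonneg)
  finally show "matrix_opnorm A \<le> K * matrix_opnorm (g \<omega> ** A)" .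
qed

lemma opnorm_right:
  assumes "\<omega> \<in> space M"
  shows "matrix_opnorm (A ** g \<omega>) \<le> K * matrix_opnorm A"
    and "matrix_opnorm A \<le> K * matrix_opnorm (A ** g \<omega>)"
proof -
  show "matrix_opnorm (A ** g \<omega>) \<le> K * matrix_opnorm A"
    using matrix_opnorm_mult_le[of A "g \<omega>"] mult_left_mono[OF g_le[OF assms] matrix_opnorm_nonneg[of A]]
    by (simp add: mult.commute)
  have "A = (A ** g \<omega>) ** h \<omega>" by (simp add: gh assms flip: matrix_mul_assoc)
  then have "matrix_opnorm A \<le> matrix_opnorm (A ** g \<omega>) * matrix_opnorm (h \<omega>)"
    using matrix_opnorm_mult_le[of "A ** g \<omega>" "h \<omega>"] by simp
  also have "\<dots> \<le> matrix_opnorm (A ** g \<omega>) * K"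
    by (intro mult_left_mono h_le assms matrix_opnorm_nonneg)
  finally show "matrix_opnorm A \<le> K * matrix_opnorm (A ** g \<omega>)" by (simp add: mult.commute)
qed

text \<open>Multiplying by an invertible factor cannot bring the norm down to 0, so the logarithm
  rules apply to all products.\<close>

lemma opnorm_pos: "\<omega> \<in> space M \<Longrightarrow> 0 < matrix_opnorm (P n \<omega>)"
proof (induction n)
  case (Suc n)
  have "0 < K * matrix_opnorm (P (Suc n) \<omega>)"
    using opnorm_left(2)[OF funpow_in_space[OF Suc.prems, of n], of "P n \<omega>"] Suc by simp
  then show ?case using K by (simp add: zero_less_mult_iff)
qed (simp add: matrix_opnorm_mat_1)

lemma ln_diff_le:
  assumes "0 < x" "0 < y" "x \<le> K * y" "y \<le> K * x"
  shows "\<bar>ln x - ln y\<bar> \<le> ln K"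
proof -
  have "ln x \<le> ln (K * y)" "ln y \<le> ln (K * x)"
    using assms K by simp_all
  then show ?thesis using assms K by (simp add: ln_mult abs_le_iff)
qed

lemma logn_Suc_diff:
  assumes "\<omega> \<in> space M"
  shows "\<bar>logn (Suc n) \<omega> - logn n \<omega>\<bar> \<le> ln K"
  unfolding logn_def cocycle_product.simps(2)
  using opnorm_pos[OF assms, of n] opnorm_pos[OF assms, of "Suc n"]
    opnorm_left[OF funpow_in_space[OF assms, of n]]
  by (intro ln_diff_le) simp_all

lemma logn_shift_diff:
  assumes "\<omega> \<in> space M"
  shows "\<bar>logn (Suc n) \<omega> - logn n (S \<omega>)\<bar> \<le> ln K"
  unfolding logn_def cocycle_product_Suc_right
  using opnorm_pos[OF measurable_space[OF S assms], of n] opnorm_pos[OF assms, of "Suc n"]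
    opnorm_right[OF assms]
  by (intro ln_diff_le) (simp_all add: cocycle_product_Suc_right del: cocycle_product.simps)

text \<open>Both products arise from the one with \<open>Suc n\<close> factors at \<omega> by
  deleting an outer factor, the rightmost or the leftmost. Each deletion costs at most
  \<open>ln K\<close>.\<close>

lemma logn_invariance_diff:
  assumes "\<omega> \<in> space M"
  shows "\<bar>logn n (S \<omega>) - logn n \<omega>\<bar> \<le> 2 * ln K"
  using logn_Suc_diff[OF assms, of n] logn_shift_diff[OF assms, of n] by linarith

lemma logn_bound: "\<omega> \<in> space M \<Longrightarrow> \<bar>logn n \<omega>\<bar> \<le> real n * ln K"
proof (induction n)
  case 0
  then show ?case by (simp add: logn_def matrix_opnorm_mat_1)
next
  case (Suc n)
  then show ?case using logn_Suc_diff[of \<omega> n] by (simp add: algebra_simps)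
qed

section \<open>Growth rates: bounds, invariance, measurability\<close>

lemma quotient_bound: "\<omega> \<in> space M \<Longrightarrow> \<bar>logn n \<omega> / real n\<bar> \<le> ln K"
  \<comment> \<open>For \<open>n = 0\<close> the quotient is 0 by the convention on division, and
    \<open>1 \<le> K\<close> gives \<open>0 \<le> ln K\<close>.\<close>
  using logn_bound[of \<omega> n] K by (cases "n = 0") (simp_all add: divide_le_eq mult.commute)

lemma quotient_invariant:
  assumes "\<omega> \<in> space M"
  shows "limsup (\<lambda>n. ereal (logn n (S \<omega>) / real n)) = limsup (\<lambda>n. ereal (logn n \<omega> / real n))"
    and "liminf (\<lambda>n. ereal (logn n (S \<omega>) / real n)) = liminf (\<lambda>n. ereal (logn n \<omega> / real n))"
proof -
  have "(\<lambda>n. logn n (S \<omega>) / real n - logn n \<omega> / real n) \<longlonglongrightarrow> 0"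
  proof (rule Lim_null_comparison)
    show "\<forall>\<^sub>F n in sequentially. norm (logn n (S \<omega>) / real n - logn n \<omega> / real n) \<le> 2 * ln K / real n"
      using logn_invariance_diff[OF assms]
      by (auto simp flip: diff_divide_distrib simp: divide_right_mono)
    show "(\<lambda>n. 2 * ln K / real n) \<longlonglongrightarrow> 0" by (rule lim_const_over_n)
  qed
  then show "limsup (\<lambda>n. ereal (logn n (S \<omega>) / real n)) = limsup (\<lambda>n. ereal (logn n \<omega> / real n))"
    and "liminf (\<lambda>n. ereal (logn n (S \<omega>) / real n)) = liminf (\<lambda>n. ereal (logn n \<omega> / real n))"
    by (rule Limsup_Liminf_eq_of_diff_tendsto_0)+
qed

lemma measurable_logn[measurable]: "logn n \<in> borel_measurable M"
proof -
  have "P n \<in> borel_measurable M"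
  proof (induction n)
    case 0
    have "P 0 = (\<lambda>_. mat 1)" by auto
    then show ?case by simp
  next
    case (Suc n)
    have [measurable]: "(S ^^ n) \<in> M \<rightarrow>\<^sub>M M" by measurable
    have "(\<lambda>\<omega>. g ((S ^^ n) \<omega>) ** P n \<omega>) \<in> borel_measurable M"
    proof (rule borel_measurable_continuous_Pair[where H = "(**)"])
      show "(\<lambda>\<omega>. g ((S ^^ n) \<omega>)) \<in> borel_measurable M" by measurable
      show "P n \<in> borel_measurable M" by (rule Suc)
      show "continuous_on UNIV (\<lambda>x. fst x ** (snd x :: complex^2^2) :: complex^2^2)"
        unfolding matrix_matrix_mult_def by (intro continuous_intros)
    qed
    then show ?case by (simp add: cocycle_product.simps(2)[abs_def])
  qed
  from measurable_compose[OF this borel_measurable_continuous_onI[OF continuous_on_matrix_opnorm]]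
  show ?thesis unfolding logn_def[abs_def] by measurable
qed

text \<open>Ergodicity concerns \<open>T\<close>, while the products run along \<open>S\<close>. If
  \<open>S\<close> undoes \<open>T\<close>, an \<open>S\<close>-invariant \<open>F\<close> satisfies
  \<open>F \<omega> = F (S (T \<omega>)) = F (T \<omega>)\<close>, so it is
  \<open>T\<close>-invariant as well.\<close>

lemma limsup_liminf_AE_const:
  assumes erg: "ergodic_transformation M T" and T: "T \<in> M \<rightarrow>\<^sub>M M"
    and ST: "S = T \<or> (\<forall>\<omega>\<in>space M. S (T \<omega>) = \<omega>)"
  shows "\<exists>a b :: real. AE \<omega> in M. limsup (\<lambda>n. ereal (logn n \<omega> / real n)) = ereal a \<and>
    liminf (\<lambda>n. ereal (logn n \<omega> / real n)) = ereal b"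
proof -
  have T_inv: "F (T \<omega>) = F \<omega>"
    if "\<And>\<omega>. \<omega> \<in> space M \<Longrightarrow> F (S \<omega>) = F \<omega>" "\<omega> \<in> space M" for F :: "'a \<Rightarrow> ereal" and \<omega>
    using ST that measurable_space[OF T] by metis
  have le: "\<bar>limsup (\<lambda>n. ereal (logn n \<omega> / real n))\<bar> \<le> ereal (ln K)"
    "\<bar>liminf (\<lambda>n. ereal (logn n \<omega> / real n))\<bar> \<le> ereal (ln K)" if "\<omega> \<in> space M" for \<omega>
  proof -
    let ?q = "\<lambda>n. ereal (logn n \<omega> / real n)"
    have q: "ereal (- ln K) \<le> ?q n" "?q n \<le> ereal (ln K)" for n
      using quotient_bound[OF that, of n] unfolding abs_le_iff by simp_all
    have "ereal (- ln K) \<le> liminf ?q" "limsup ?q \<le> ereal (ln K)"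
      using q by (auto intro!: Liminf_bounded Limsup_bounded always_eventually)
    moreover have "liminf ?q \<le> limsup ?q" by (rule Liminf_le_Limsup) simp
    ultimately have b: "ereal (- ln K) \<le> liminf ?q" "limsup ?q \<le> ereal (ln K)"
      "ereal (- ln K) \<le> limsup ?q" "liminf ?q \<le> ereal (ln K)"
      by (blast intro: order_trans)+
    show "\<bar>limsup ?q\<bar> \<le> ereal (ln K)" using b(2,3) by (cases "limsup ?q") (auto simp: abs_le_iff)
    show "\<bar>liminf ?q\<bar> \<le> ereal (ln K)" using b(1,4) by (cases "liminf ?q") (auto simp: abs_le_iff)
  qed
  have "\<exists>c::real. AE \<omega> in M. limsup (\<lambda>n. ereal (logn n \<omega> / real n)) = ereal c"
  proof (rule ergodic_invariant_AE_const[OF erg T])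
    show "(\<lambda>\<omega>. limsup (\<lambda>n. ereal (logn n \<omega> / real n))) \<in> borel_measurable M"
      by measurable
    show "limsup (\<lambda>n. ereal (logn n (T \<omega>) / real n)) = limsup (\<lambda>n. ereal (logn n \<omega> / real n))"
      if "\<omega> \<in> space M" for \<omega>
      using T_inv[where F = "\<lambda>\<omega>. limsup (\<lambda>n. ereal (logn n \<omega> / real n))", OF quotient_invariant(1) that]
      by simp
  qed (rule le(1))
  then obtain a where a: "AE \<omega> in M. limsup (\<lambda>n. ereal (logn n \<omega> / real n)) = ereal a"
    by blast
  have "\<exists>c::real. AE \<omega> in M. liminf (\<lambda>n. ereal (logn n \<omega> / real n)) = ereal c"
  proof (rule ergodic_invariant_AE_const[OF erg T])
    show "(\<lambda>\<omega>. liminf (\<lambda>n. ereal (logn n \<omega> / real n))) \<in> borel_measurable M"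
      by measurable
    show "liminf (\<lambda>n. ereal (logn n (T \<omega>) / real n)) = liminf (\<lambda>n. ereal (logn n \<omega> / real n))"
      if "\<omega> \<in> space M" for \<omega>
      using T_inv[where F = "\<lambda>\<omega>. liminf (\<lambda>n. ereal (logn n \<omega> / real n))", OF quotient_invariant(2) that]
      by simp
  qed (rule le(2))
  then obtain b where b: "AE \<omega> in M. liminf (\<lambda>n. ereal (logn n \<omega> / real n)) = ereal b"
    by blast
  from a b have "AE \<omega> in M. limsup (\<lambda>n. ereal (logn n \<omega> / real n)) = ereal a \<and>
    liminf (\<lambda>n. ereal (logn n \<omega> / real n)) = ereal b" by (rule AE_conjI)
  then show ?thesis by blast
qed

end

section \<open>Transfer matrices\<close>

text \<open>The transfer matrix has determinant 1, so its inverse is its adjugate, written out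
  here.\<close>

definition transfer_matrix_inv :: "('a \<Rightarrow> real) \<Rightarrow> complex \<Rightarrow> 'a \<Rightarrow> complex^2^2" where
  "transfer_matrix_inv f E \<omega> = vector [vector [0, 1], vector [-1, E - complex_of_real (f \<omega>)]]"

lemma transfer_matrix_inv:
  "transfer_matrix f E \<omega> ** transfer_matrix_inv f E \<omega> = mat 1"
  "transfer_matrix_inv f E \<omega> ** transfer_matrix f E \<omega> = mat 1"
  by (simp_all add: transfer_matrix_def transfer_matrix_inv_def matrix_matrix_mult_def mat_def
      vec_eq_iff forall_2 sum_2)

lemma matrix_inv_transfer_matrix: "matrix_inv (transfer_matrix f E \<omega>) = transfer_matrix_inv f E \<omega>"
proof -
  let ?A = "transfer_matrix f E \<omega>"
  \<comment> \<open>\<open>matrix_inv\<close> is a choice of a two-sided inverse; the explicit one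
    shows that the choice succeeds, and uniqueness of inverses identifies the two.\<close>
  have "?A ** matrix_inv ?A = mat 1 \<and> matrix_inv ?A ** ?A = mat 1"
    unfolding matrix_inv_def by (rule someI[of _ "transfer_matrix_inv f E \<omega>"]) (simp add: transfer_matrix_inv)
  then have "matrix_inv ?A ** (?A ** transfer_matrix_inv f E \<omega>) = transfer_matrix_inv f E \<omega>"
    by (simp add: matrix_mul_assoc)
  then show ?thesis by (simp add: transfer_matrix_inv)
qed

lemma continuous_on_vector_2:
  fixes a b :: "'b::topological_space \<Rightarrow> 'c::real_normed_vector"
  assumes "continuous_on A a" "continuous_on A b"
  shows "continuous_on A (\<lambda>x. vector [a x, b x] :: 'c^2)"
proof -
  have eq: "(\<lambda>x. vector [a x, b x] :: 'c^2) = (\<lambda>x. \<chi> i. if i = 1 then a x else b x)"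
    by (auto simp: vec_eq_iff forall_2)
  have "continuous_on A (\<lambda>x. if i = 1 then a x else b x)" for i :: 2
    using assms by (cases "i = 1") simp_all
  then show ?thesis unfolding eq by (rule continuous_on_vec_lambda)
qed

text \<open>With the identity as potential, the matrices become functions of the real value of
  \<open>f\<close>. Measurability and boundedness for general \<open>f\<close> follow by
  composition.\<close>

lemma continuous_on_transfer_matrix:
  "continuous_on A (\<lambda>x. transfer_matrix (\<lambda>x. x) E x)"
  "continuous_on A (\<lambda>x. transfer_matrix_inv (\<lambda>x. x) E x)"
  unfolding transfer_matrix_def transfer_matrix_inv_def
  by (intro continuous_on_vector_2 continuous_intros)+

lemma transfer_matrix_eq:
  "transfer_matrix f E \<omega> = transfer_matrix (\<lambda>x. x) E (f \<omega>)"
  "transfer_matrix_inv f E \<omega> = transfer_matrix_inv (\<lambda>x. x) E (f \<omega>)"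
  by (simp_all add: transfer_matrix_def transfer_matrix_inv_def)

lemma borel_measurable_transfer_matrix:
  assumes "f \<in> borel_measurable M"
  shows "transfer_matrix f E \<in> borel_measurable M" "transfer_matrix_inv f E \<in> borel_measurable M"
proof -
  have eq: "transfer_matrix f E = (\<lambda>\<omega>. transfer_matrix (\<lambda>x. x) E (f \<omega>))"
    "transfer_matrix_inv f E = (\<lambda>\<omega>. transfer_matrix_inv (\<lambda>x. x) E (f \<omega>))"
    by (rule ext, rule transfer_matrix_eq)+
  show "transfer_matrix f E \<in> borel_measurable M" "transfer_matrix_inv f E \<in> borel_measurable M"
    unfolding eq
    by (rule measurable_compose[OF assms borel_measurable_continuous_onI[OF continuous_on_transfer_matrix(1)]]
        measurable_compose[OF assms borel_measurable_continuous_onI[OF continuous_on_transfer_matrix(2)]])+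
qed

text \<open>The values of \<open>f\<close> lie in a compact ball, on which the continuous norms are
  bounded.\<close>

lemma transfer_matrix_opnorm_bounded:
  assumes "bounded (f ` X)"
  obtains K where "1 \<le> K" "\<And>\<omega>. \<omega> \<in> X \<Longrightarrow> matrix_opnorm (transfer_matrix f E \<omega>) \<le> K"
    "\<And>\<omega>. \<omega> \<in> X \<Longrightarrow> matrix_opnorm (transfer_matrix_inv f E \<omega>) \<le> K"
proof -
  obtain C where C: "f ` X \<subseteq> cball 0 C"
    using assms unfolding bounded_iff by (metis mem_cball_0 subsetI)
  have bdd: "\<exists>K. \<forall>\<omega>\<in>X. matrix_opnorm (m (f \<omega>)) \<le> K" if "continuous_on (cball 0 C) m" for m
  proof -
    have "continuous_on (cball 0 C) (\<lambda>x. matrix_opnorm (m x))"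
      by (rule continuous_on_compose2[OF continuous_on_matrix_opnorm that]) simp
    then have "bounded ((\<lambda>x. matrix_opnorm (m x)) ` cball 0 C)"
      by (intro compact_imp_bounded compact_continuous_image compact_cball)
    then obtain K where "\<forall>x\<in>cball 0 C. norm (matrix_opnorm (m x)) \<le> K"
      by (auto simp: bounded_iff)
    then show ?thesis using C by (intro exI[of _ K]) (auto simp: abs_le_iff)
  qed
  obtain K1 where K1: "\<forall>\<omega>\<in>X. matrix_opnorm (transfer_matrix f E \<omega>) \<le> K1"
    using bdd[OF continuous_on_transfer_matrix(1)] unfolding transfer_matrix_eq(1)[of f] by blast
  obtain K2 where K2: "\<forall>\<omega>\<in>X. matrix_opnorm (transfer_matrix_inv f E \<omega>) \<le> K2"
    using bdd[OF continuous_on_transfer_matrix(2)] unfolding transfer_matrix_eq(2)[of f] by blast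
  show ?thesis
    by (rule that[of "max 1 (max K1 K2)"]) (use K1 K2 in \<open>auto simp: le_max_iff_disj\<close>)
qed

lemma transfer_forward_eq_cocycle_product:
  "transfer_forward T f E n \<omega> = cocycle_product T (transfer_matrix f E) n \<omega>"
  by (induction n) auto

text \<open>The backward product starts at \<open>S \<omega>\<close> rather than at \<omega>; this
  shift by one is absorbed into the factor.\<close>

lemma transfer_backward_eq_cocycle_product:
  "transfer_backward S f E n \<omega> = cocycle_product S (\<lambda>\<omega>. transfer_matrix_inv f E (S \<omega>)) n \<omega>"
  by (induction n) (auto simp: matrix_inv_transfer_matrix)

section \<open>Limits along the integers as limits of sequences\<close>

lemma at_top_int_eq: "(at_top :: int filter) = filtermap int sequentially"
proof (rule antisym)
  show "filtermap int sequentially \<le> at_top"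
    using filterlim_int_sequentially by (simp add: filterlim_def)
  show "at_top \<le> filtermap int sequentially"
  proof (rule filter_leI)
    fix P assume "eventually P (filtermap int sequentially)"
    then obtain N where "\<And>n. N \<le> n \<Longrightarrow> P (int n)"
      by (auto simp: eventually_filtermap eventually_sequentially)
    then have "P k" if "int N \<le> k" for k
      using that by (cases k) auto
    then show "eventually P at_top"
      by (auto simp: eventually_at_top_linorder)
  qed
qed

lemma Limsup_Liminf_int_at_top:
  fixes u :: "int \<Rightarrow> ereal"
  shows "Limsup at_top u = limsup (\<lambda>n. u (int n))" "Liminf at_top u = liminf (\<lambda>n. u (int n))"
  by (simp_all add: at_top_int_eq Limsup_filtermap_eq Liminf_filtermap_eq)

lemma Limsup_Liminf_int_at_bot:
  fixes u :: "int \<Rightarrow> ereal"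
  shows "Limsup at_bot u = limsup (\<lambda>n. u (- int n))" "Liminf at_bot u = liminf (\<lambda>n. u (- int n))"
  by (simp_all add: at_bot_mirror Limsup_filtermap_eq Liminf_filtermap_eq Limsup_Liminf_int_at_top)

theorem theorem6p1:
  fixes M :: "'a measure" and T :: "'a \<Rightarrow> 'a" and f :: "'a \<Rightarrow> real"
  assumes "sigma_finite_measure M"
    and "emeasure M (space M) = \<infinity>"
    and "T \<in> M \<rightarrow>\<^sub>M M"
    and "nonsingular_transformation M T"
    and "invertible_transformation M T"
    and "ergodic_transformation M T"
    and "conservative_transformation M T"
    and "f \<in> borel_measurable M"
    and "bounded (f ` space M)"
  shows "\<forall>E::complex. \<exists>Lsup_plus Linf_plus Lsup_minus Linf_minus :: real.
     AE \<omega> in M.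
       Limsup at_top (\<lambda>n::int. ereal (lyapunov_quotient M T f E \<omega> n)) = ereal Lsup_plus \<and>
       Liminf at_top (\<lambda>n::int. ereal (lyapunov_quotient M T f E \<omega> n)) = ereal Linf_plus \<and>
       Limsup at_bot (\<lambda>n::int. ereal (lyapunov_quotient M T f E \<omega> n)) = ereal Lsup_minus \<and>
       Liminf at_bot (\<lambda>n::int. ereal (lyapunov_quotient M T f E \<omega> n)) = ereal Linf_minus"
proof
  fix E :: complex
  let ?S = "inv_into (space M) T"
  let ?A = "transfer_matrix f E" and ?B = "transfer_matrix_inv f E"
  have T: "T \<in> M \<rightarrow>\<^sub>M M" by fact
  have bij: "bij_betw T (space M) (space M)" and S[measurable]: "?S \<in> M \<rightarrow>\<^sub>M M"
    using assms(5) by (auto simp: invertible_transformation_def)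
  have ST: "\<forall>\<omega>\<in>space M. ?S (T \<omega>) = \<omega>"
    using bij by (auto simp: bij_betw_def)
  have [measurable]: "?A \<in> borel_measurable M" "?B \<in> borel_measurable M"
    using borel_measurable_transfer_matrix assms(8) by blast+
  obtain K where K: "1 \<le> K" "\<And>\<omega>. \<omega> \<in> space M \<Longrightarrow> matrix_opnorm (?A \<omega>) \<le> K"
    "\<And>\<omega>. \<omega> \<in> space M \<Longrightarrow> matrix_opnorm (?B \<omega>) \<le> K"
    using transfer_matrix_opnorm_bounded[OF assms(9)] by blast
  interpret fw: bounded_cocycle M T ?A ?B K
    using T K by unfold_locales (auto simp: transfer_matrix_inv)
  \<comment> \<open>Backwards the roles are exchanged: the inverse matrix is the factor and the
    transfer matrix its inverse, both taken at \<open>?S \<omega>\<close>.\<close>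
  interpret bw: bounded_cocycle M ?S "\<lambda>\<omega>. ?B (?S \<omega>)" "\<lambda>\<omega>. ?A (?S \<omega>)" K
    using K measurable_space[OF S] by unfold_locales (auto simp: transfer_matrix_inv)
  have fw_eq: "lyapunov_quotient M T f E \<omega> (int n) = fw.logn n \<omega> / real n" for \<omega> n
    by (simp add: lyapunov_quotient_def transfer_cocycle_def fw.logn_def
        transfer_forward_eq_cocycle_product)
  have bw_eq: "lyapunov_quotient M T f E \<omega> (- int n) = bw.logn n \<omega> / real n" for \<omega> n
    \<comment> \<open>At 0 the cocycle takes its forward branch, so this case is separate; both
      quotients are then 0.\<close>
    by (cases "n = 0") (simp_all add: lyapunov_quotient_def transfer_cocycle_def bw.logn_def
        transfer_backward_eq_cocycle_product)
  obtain a b where ab: "AE \<omega> in M. limsup (\<lambda>n. ereal (fw.logn n \<omega> / real n)) = ereal a \<and>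
      liminf (\<lambda>n. ereal (fw.logn n \<omega> / real n)) = ereal b"
    using fw.limsup_liminf_AE_const[OF assms(6) T] by blast
  obtain c d where cd: "AE \<omega> in M. limsup (\<lambda>n. ereal (bw.logn n \<omega> / real n)) = ereal c \<and>
      liminf (\<lambda>n. ereal (bw.logn n \<omega> / real n)) = ereal d"
    \<comment> \<open>The second alternative for \<open>S\<close> applies here, so ergodicity of
      \<open>T\<close> also settles the backward direction.\<close>
    using bw.limsup_liminf_AE_const[OF assms(6) T] ST by blast
  show "\<exists>Lsup_plus Linf_plus Lsup_minus Linf_minus :: real. AE \<omega> in M.
       Limsup at_top (\<lambda>n::int. ereal (lyapunov_quotient M T f E \<omega> n)) = ereal Lsup_plus \<and>
       Liminf at_top (\<lambda>n::int. ereal (lyapunov_quotient M T f E \<omega> n)) = ereal Linf_plus \<and>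
       Limsup at_bot (\<lambda>n::int. ereal (lyapunov_quotient M T f E \<omega> n)) = ereal Lsup_minus \<and>
       Liminf at_bot (\<lambda>n::int. ereal (lyapunov_quotient M T f E \<omega> n)) = ereal Linf_minus"
    unfolding Limsup_Liminf_int_at_top Limsup_Liminf_int_at_bot fw_eq bw_eq
    using AE_conjI[OF ab cd] by (intro exI[of _ a] exI[of _ b] exI[of _ c] exI[of _ d]) simp
qed

end
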